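(* For all integers $n \geq 1$ and all real $x$, \begin{align*} c_{2n}(x) & = n \sum_{m=1}^n \frac{u(n,m)}{m} \big( (x+n-1)^{2m} - B_{2m} \big), \\ \widehat{c}_{2n}(x) & = n \sum_{m=1}^n \frac{u(n,m)}{m} \big( (x-n)^{2m} - B_{2m} \big), \\ c_{2n+1}(x) & = -(2n+1) \sum_{m=1}^n \frac{u(n,m)}{2m+1} E_{2m+1}(x+n), \\ \widehat{c}_{2n+1}(x) & = (2n+1) \sum_{m=1}^n \frac{u(n,m)}{2m+1} E_{2m+1}(x -n). \end{align*}
   Context: For real $z$ and integer $n\ge 0$, $\binom{z}{n} = \frac{z(z-1)\cdots(z-n+1)}{n!}$. The Cauchy polynomials of the first and second kind are $c_n(x) = n! \int_{0}^{1} \binom{t - x}{n}\, dt$ and $\widehat{c}_n(x) = n! \int_{0}^{1} \binom{x - t}{n}\, dt$, $n \ge 0$. $u(n,m)=t(2n,2m)$ are the (signed) central factorial numbers of the first kind with even indices, i.e. the coefficients in $\prod_{j=0}^{n-1}(z^2-j^2)=\sum_{m=1}^{n} u(n,m) z^{2m}$ for $n \ge 1$. $B_m$ are the Bernoulli numbers, $\frac{t}{e^t-1}=\sum_{m\ge0} B_m \frac{t^m}{m!}$, and $E_m(x)$ are the Euler polynomials, $\frac{2e^{xt}}{e^t+1}=\sum_{m\ge0}E_m(x)\frac{t^m}{m!}$. *)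

theory Defs
  imports
    "HOL-Analysis.Analysis"
    "HOL-Computational_Algebra.Computational_Algebra"
begin

definition cauchy1 :: "nat \<Rightarrow> real \<Rightarrow> real" where
  "cauchy1 n x = fact n * integral {0..1} (\<lambda>t. (t - x) gchoose n)"

definition cauchy2 :: "nat \<Rightarrow> real \<Rightarrow> real" where
  "cauchy2 n x = fact n * integral {0..1} (\<lambda>t. (x - t) gchoose n)"

(* The product is a polynomial in z, so the coefficient of z^(2m) is read off at index 2 * m. *)
definition central_factorial :: "nat \<Rightarrow> nat \<Rightarrow> real" where
  "central_factorial n m = coeff (\<Prod>j<n. [:0, 1:] ^ 2 - [:real j ^ 2:]) (2 * m)"

(* The divisor fps_exp 1 - 1 has zero constant term, but division of power series over a field
   cancels the common factor t; see bernoulli_fps below. *)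
definition bernoulli :: "nat \<Rightarrow> real" where
  "bernoulli m = fact m * fps_nth (fps_X / (fps_exp 1 - 1)) m"

definition euler_poly :: "nat \<Rightarrow> real \<Rightarrow> real" where
  "euler_poly m x = fact m * fps_nth (2 * fps_exp x / (fps_exp 1 + 1)) m"

lemma central_factorial_expansion:
  fixes z :: real
  assumes "n \<ge> 1"
  shows "(\<Prod>j<n. z ^ 2 - real j ^ 2) = (\<Sum>m=1..n. central_factorial n m * z ^ (2 * m))"
proof -
  define p where "p n = (\<Prod>j<n. [:- (real j ^ 2), 1:])" for n
  have degp: "degree (p n) \<le> n" for n
  proof -
    have "degree (p n) \<le> sum (degree \<circ> (\<lambda>j. [:- (real j ^ 2), 1:])) {..<n}"
      unfolding p_def by (rule degree_prod_sum_le) simp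
    then show ?thesis by simp
  qed
  have comp: "(\<Prod>j<n. [:0, 1:] ^ 2 - [:real j ^ 2:]) = pcompose (p n) (monom 1 2)" for n
    unfolding p_def pcompose_prod
  proof (rule prod.cong)
    fix j
    show "[:0, 1:] ^ 2 - [:real j ^ 2:] = pcompose [:- (real j ^ 2), 1:] (monom 1 2)"
      by (rule poly_eqI) (simp add: pcompose_pCons monom_altdef coeff_pCons split: nat.split)
  qed simp
  have cf: "central_factorial n m = coeff (p n) m" for m
  proof -
    have "coeff (pcompose q (monom 1 2)) (2 * k) = coeff q k" for q :: "real poly" and k
    proof (induction q arbitrary: k)
      case (pCons a q)
      then show ?case
        by (cases k) (simp_all add: pcompose_pCons coeff_monom_mult)
    qed simp
    then show ?thesis unfolding central_factorial_def comp by simp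
  qed
  have p0: "coeff (p n) 0 = 0"
  proof -
    have "coeff (p n) 0 = poly (p n) 0" by (simp add: poly_0_coeff_0)
    also have "\<dots> = 0" using assms by (auto simp: p_def poly_prod intro!: bexI[of _ 0])
    finally show ?thesis .
  qed
  have "(\<Prod>j<n. z ^ 2 - real j ^ 2) = poly (p n) (z ^ 2)"
    by (simp add: p_def poly_prod)
  also have "\<dots> = (\<Sum>m\<le>n. coeff (p n) m * (z ^ 2) ^ m)"
    unfolding poly_altdef
    by (rule sum.mono_neutral_left) (use degp in \<open>auto simp: coeff_eq_0\<close>)
  also have "\<dots> = (\<Sum>m=1..n. coeff (p n) m * (z ^ 2) ^ m)"
    using p0 by (simp add: atMost_atLeast0 sum.atLeast_Suc_atMost)
  finally show ?thesis by (simp add: cf power_mult)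
qed

lemma bernoulli_fps:
  "Abs_fps (\<lambda>m. bernoulli m / fact m) * (fps_exp 1 - 1) = fps_X"
proof -
  have nz: "fps_nth (fps_exp 1 - 1 :: real fps) 1 \<noteq> 0" by simp
  then have ne: "(fps_exp 1 - 1 :: real fps) \<noteq> 0" by fastforce
  have "subdegree (fps_exp 1 - 1 :: real fps) \<le> 1"
    by (rule subdegree_leI) (rule nz)
  then have "(fps_exp 1 - 1 :: real fps) dvd fps_X"
    using ne by (subst fps_dvd_iff) auto
  then have "fps_X / (fps_exp 1 - 1 :: real fps) * (fps_exp 1 - 1) = fps_X" by simp
  moreover have "Abs_fps (\<lambda>m. bernoulli m / fact m) = fps_X / (fps_exp 1 - 1)"
    by (rule fps_ext) (simp add: bernoulli_def)
  ultimately show ?thesis by simp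
qed

lemma euler_poly_fps:
  "Abs_fps (\<lambda>m. euler_poly m x / fact m) * (fps_exp 1 + 1) = 2 * fps_exp x"
proof -
  have "(fps_exp 1 + 1 :: real fps) dvd 2 * fps_exp x"
  proof -
    have "fps_nth (fps_exp 1 + 1 :: real fps) 0 \<noteq> 0" by simp
    then show ?thesis by (meson fps_is_unit_iff unit_imp_dvd)
  qed
  then have "2 * fps_exp x / (fps_exp 1 + 1 :: real fps) * (fps_exp 1 + 1) = 2 * fps_exp x" by simp
  moreover have "Abs_fps (\<lambda>m. euler_poly m x / fact m) = 2 * fps_exp x / (fps_exp 1 + 1)"
    by (rule fps_ext) (simp add: euler_poly_def)
  ultimately show ?thesis by simp
qed

end

theory Submission
  imports Defs
begin

text \<open>
  Let \<open>F\<close> be a polynomial antiderivative of the falling factorial \<open>f(s) = s(s-1)\<dots>(s-k+1)\<close>, so that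
  \<open>c\<^sub>k(x) = F(1-x) - F(-x)\<close>; the second kind is \<open>c\<^sub>k(1-x)\<close>.

  For \<open>k = 2n\<close> and \<open>z = x+n-1\<close> the derivative of \<open>c\<^sub>k\<close> is \<open>f(-x) - f(1-x)\<close>, in which the common factors
  of \<open>f\<close> combine to \<open>2n z\<^sup>-\<^sup>1 \<Prod>\<^sub>j(z\<^sup>2-j\<^sup>2)\<close>. This gives \<open>c\<^sub>k\<close> up to a constant. The constant comes from the umbral
  functional \<open>z\<^sup>m \<mapsto> B\<^sub>m\<close>, which maps \<open>G(z+1) - G(z)\<close> to \<open>G'(0)\<close>: here \<open>G(z) = F(n-z)\<close>
  and \<open>G'(0) = -f(n) = 0\<close>.

  For \<open>k = 2n+1\<close> and \<open>z = x+n\<close>, the sum \<open>c\<^sub>k(x) + c\<^sub>k(x+1)\<close> has derivative \<open>-2(2n+1) \<Prod>\<^sub>j(z\<^sup>2-j\<^sup>2)\<close> and vanishes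
  at \<open>z = 0\<close> because \<open>f\<close> is odd about \<open>n\<close>. As \<open>E\<^sub>m(z+1) + E\<^sub>m(z) = 2z\<^sup>m\<close>, both sides of the claim solve the same
  difference equation, and a polynomial \<open>p\<close> with \<open>p(z+1) = -p(z)\<close> is zero.
\<close>

section \<open>Cauchy polynomials through antiderivatives\<close>

lemma pderiv_sum: "pderiv (sum f A) = (\<Sum>x\<in>A. pderiv (f x))"
  using higher_pderiv_sum[of 1] by simp

lemma poly_antideriv_exists:
  fixes p :: "'a::field_char_0 poly"
  shows "\<exists>q. pderiv q = p"
proof
  define q where "q = (\<Sum>i\<le>degree p. monom (coeff p i / of_nat (Suc i)) (Suc i))"
  have "pderiv q = (\<Sum>i\<le>degree p. monom (coeff p i) i)"
    unfolding q_def pderiv_sum by (intro sum.cong) (simp_all add: pderiv_monom del: of_nat_Suc)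
  then show "pderiv q = p"
    by (simp add: poly_as_sum_of_monoms)
qed

lemma cauchy1_conv_antideriv:
  fixes F :: "real poly"
  assumes "\<And>s. poly (pderiv F) s = (\<Prod>i<k. s - real i)"
  shows "cauchy1 k x = poly F (1 - x) - poly F (- x)"
proof -
  have "((\<lambda>t. poly (pderiv F) (t - x)) has_integral (poly F (1 - x) - poly F (0 - x))) {0..1}"
  proof (rule fundamental_theorem_of_calculus)
    fix t :: real
    have "((\<lambda>t. poly F (t - x)) has_real_derivative poly (pderiv F) (t - x)) (at t within {0..1})"
      by (auto intro!: derivative_eq_intros poly_DERIV[THEN DERIV_chain2])
    then show "((\<lambda>t. poly F (t - x)) has_vector_derivative poly (pderiv F) (t - x)) (at t within {0..1})"
      by (simp add: has_real_derivative_iff_has_vector_derivative)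
  qed simp
  then have "integral {0..1} (\<lambda>t. fact k * ((t - x) gchoose k)) = poly F (1 - x) - poly F (- x)"
    by (simp add: gbinomial_mult_fact atLeast0LessThan assms integral_unique)
  then show ?thesis
    by (simp add: cauchy1_def)
qed

text \<open>Substitute \<open>1 - t\<close> for \<open>t\<close>, as a reflection followed by a
  shift of the interval.\<close>

lemma cauchy2_conv_cauchy1: "cauchy2 k x = cauchy1 k (1 - x)"
proof -
  have "integral {0..1} (\<lambda>t. (x - t) gchoose k) = integral {-1..0} (\<lambda>t. (x - - t) gchoose k)"
    using Henstock_Kurzweil_Integration.integral_reflect_real
      [where f = "\<lambda>t. (x - t) gchoose k" and a = 0 and b = 1] by simp
  also have "\<dots> = integral {0..1} (\<lambda>t. (t - (1 - x)) gchoose k)"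
    using integral_shift_real_ivl[where f = "\<lambda>t. (x - - t) gchoose k" and a = "-1" and b = 0 and c = "-1"]
    by (simp add: algebra_simps)
  finally show ?thesis
    by (simp add: cauchy1_def cauchy2_def)
qed

section \<open>Products symmetric about their middle factor\<close>

text \<open>The factors are \<open>j - z\<close> for integers \<open>j\<close> from
  \<open>-n\<close> to \<open>n\<close>. Those for \<open>j\<close> and \<open>-j\<close> multiply
  to \<open>z^2 - j^2\<close>, and the middle one, \<open>-z\<close>, joins the extra
  \<open>z\<close> to give \<open>-(z^2 - 0^2)\<close>.\<close>

lemma prod_centered:
  fixes z :: real
  shows "z * (\<Prod>i<2 * n + 1. real n - z - real i) = - (\<Prod>j<Suc n. z ^ 2 - real j ^ 2)"
proof (induction n)
  case 0
  show ?case by (simp add: power2_eq_square)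
next
  case (Suc n)
  have "(\<Prod>i<2 * Suc n + 1. real (Suc n) - z - real i) =
      (\<Prod>i<Suc (Suc (2 * n + 1)). real (Suc n) - z - real i)" by simp
  also have "\<dots> = (real (Suc n) - z) * (\<Prod>i<2 * n + 1. real n - z - real i) *
      (- real (Suc n) - z)"
    by (subst prod.lessThan_Suc, subst prod.lessThan_Suc_shift) (simp add: algebra_simps)
  also have "z * \<dots> = (z * (\<Prod>i<2 * n + 1. real n - z - real i)) * (z ^ 2 - real (Suc n) ^ 2)"
    by (simp add: algebra_simps power2_eq_square)
  finally show ?case by (simp only: Suc.IH) simp
qed

text \<open>The right side of \<open>prod_centered\<close> is even in \<open>z\<close>, so the
  product alone is odd. Dividing by \<open>w\<close> excludes \<open>w = 0\<close>, where the factor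
  with \<open>i = n\<close> vanishes.\<close>

lemma prod_centered_odd:
  fixes w :: real
  shows "(\<Prod>i<2 * n + 1. real n - w - real i) = - (\<Prod>i<2 * n + 1. real n + w - real i)"
proof (cases "w = 0")
  case True
  have "(\<Prod>i<2 * n + 1. real n - real i) = 0" by (auto intro!: prod_zero bexI[of _ n])
  then show ?thesis using True by simp
next
  case False
  have "w * (\<Prod>i<2 * n + 1. real n - w - real i) = w * - (\<Prod>i<2 * n + 1. real n + w - real i)"
    using prod_centered[of w n] prod_centered[of "- w" n]
    by (simp only: power2_minus diff_minus_eq_add mult_minus_left mult_minus_right)
  with False show ?thesis using mult_left_cancel by blast
qed

section \<open>The umbral Bernoulli functional\<close>

definition bernoulli_functional :: "real poly \<Rightarrow> real" where
  "bernoulli_functional p = (\<Sum>i\<le>degree p. coeff p i * bernoulli i)"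

text \<open>Gives polynomials of different degrees one summation range, as additivity needs.\<close>

lemma bernoulli_functional_altdef:
  assumes "degree p \<le> N"
  shows "bernoulli_functional p = (\<Sum>i\<le>N. coeff p i * bernoulli i)"
  unfolding bernoulli_functional_def
  by (rule sum.mono_neutral_left) (use assms in \<open>auto simp: coeff_eq_0\<close>)

lemma bernoulli_functional_add:
  "bernoulli_functional (p + q) = bernoulli_functional p + bernoulli_functional q"
proof -
  define N where "N = max (degree p) (degree q)"
  have "degree (p + q) \<le> N" by (simp add: N_def degree_add_le)
  then show ?thesis
    by (simp add: bernoulli_functional_altdef[of _ N] N_def sum.distrib algebra_simps)
qed

lemma bernoulli_functional_smult:
  "bernoulli_functional (smult c p) = c * bernoulli_functional p"
  by (simp add: bernoulli_functional_altdef[of _ "degree p"] sum_distrib_left mult.assoc)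

lemma bernoulli_functional_monom: "bernoulli_functional (monom c m) = c * bernoulli m"
  by (simp add: bernoulli_functional_altdef[of _ m] degree_monom_le if_distrib[of "\<lambda>x. x * _"] cong: if_cong)

lemma bernoulli_functional_sum:
  "bernoulli_functional (\<Sum>i\<in>A. p i) = (\<Sum>i\<in>A. bernoulli_functional (p i))"
  by (induction A rule: infinite_finite_induct)
    (simp_all add: bernoulli_functional_add, simp_all add: bernoulli_functional_def)

text \<open>Compare coefficients of \<open>t^m\<close> in \<open>bernoulli_fps\<close> and multiply
  by \<open>m!\<close>.\<close>

lemma bernoulli_recurrence:
  "(\<Sum>k\<le>m. real (m choose k) * bernoulli k) - bernoulli m = (if m = 1 then 1 else 0)"
proof -
  have "fps_nth (Abs_fps (\<lambda>m. bernoulli m / fact m) * (fps_exp 1 - 1)) m = fps_nth fps_X m"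
    by (simp only: bernoulli_fps)
  then have "(\<Sum>k\<le>m. bernoulli k / fact k / fact (m - k)) - bernoulli m / fact m
      = (if m = 1 then 1 else 0)"
    by (simp add: right_diff_distrib fps_mult_nth atMost_atLeast0)
  then have "fact m * (\<Sum>k\<le>m. bernoulli k / fact k / fact (m - k)) - bernoulli m
      = (if m = 1 then 1 else 0)"
    by (simp add: field_simps split: if_splits)
  moreover have "fact m * (\<Sum>k\<le>m. bernoulli k / fact k / fact (m - k)) =
      (\<Sum>k\<le>m. real (m choose k) * bernoulli k)"
    unfolding sum_distrib_left by (intro sum.cong) (simp_all add: binomial_fact)
  ultimately show ?thesis by simp
qed

text \<open>On monomials this is the umbral form \<open>(B+1)^m - B^m = [m = 1]\<close> of the
  recurrence; linearity does the rest. The right side is the derivative of \<open>p\<close> at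
  0.\<close>

lemma bernoulli_functional_shift:
  "bernoulli_functional (pcompose p [:1, 1:] - p) = coeff p 1"
proof -
  have monom: "bernoulli_functional (pcompose (monom c m) [:1, 1:]) =
      bernoulli_functional (monom c m) + (if m = 1 then c else 0)" for c m
  proof -
    have "pcompose (monom c m) [:1, 1:] = smult c ([:1, 1:] ^ m)"
      by (simp add: poly_eq_poly_eq_iff[symmetric] fun_eq_iff poly_pcompose poly_monom add.commute)
    moreover have "bernoulli_functional ([:1, 1:] ^ m) = (\<Sum>k\<le>m. real (m choose k) * bernoulli k)"
      by (subst bernoulli_functional_altdef[of _ m])
        (auto simp: degree_linear_power coeff_linear_poly_power)
    ultimately show ?thesis
      using bernoulli_recurrence[of m]
      by (simp add: bernoulli_functional_smult bernoulli_functional_monom algebra_simps split: if_splits)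
  qed
  have "bernoulli_functional (pcompose p [:1, 1:]) =
      bernoulli_functional (pcompose (\<Sum>i\<le>degree p. monom (coeff p i) i) [:1, 1:])"
    by (simp add: poly_as_sum_of_monoms)
  also have "\<dots> = bernoulli_functional (\<Sum>i\<le>degree p. monom (coeff p i) i) +
      (\<Sum>i\<le>degree p. if i = 1 then coeff p i else 0)"
    by (simp add: pcompose_sum bernoulli_functional_sum monom sum.distrib)
  also have "(\<Sum>i\<le>degree p. if i = 1 then coeff p i else 0) = coeff p 1"
    by (auto simp: coeff_eq_0)
  finally show ?thesis
    using bernoulli_functional_add[of "pcompose p [:1, 1:] - p" p]
    by (simp add: poly_as_sum_of_monoms)
qed

section \<open>Euler polynomials and their difference equation\<close>

text \<open>Two steps give period 2, so \<open>p\<close> takes the value \<open>p(0)\<close>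
  infinitely often and is constant; the constant equals its own negative.\<close>

lemma poly_antiperiodic_eq_0:
  fixes p :: "real poly"
  assumes "\<And>x. poly p (x + 1) = - poly p x"
  shows "p = 0"
proof -
  have "poly p (2 * real k) = poly p 0" for k
  proof (induction k)
    case (Suc k)
    have "poly p (2 * real (Suc k)) = poly p (2 * real k + 1 + 1)" by (simp add: algebra_simps)
    also have "\<dots> = poly p 0" by (simp only: assms Suc.IH minus_minus)
    finally show ?case .
  qed simp
  then have "range (\<lambda>k. 2 * real k) \<subseteq> {x. poly (p - [:poly p 0:]) x = 0}" by auto
  moreover have "infinite (range (\<lambda>k. 2 * real k))"
    by (intro range_inj_infinite) (auto simp: inj_on_def)
  ultimately have "p - [:poly p 0:] = 0"
    using poly_roots_finite finite_subset by blast
  then have "p = [:poly p 0:]" by simp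
  then have "poly p 1 = poly p 0" by (metis poly_const_conv)
  with assms[of 0] have "poly p 0 = 0" by simp
  with \<open>p = [:poly p 0:]\<close> show ?thesis by simp
qed

text \<open>Only \<open>exp(xt)\<close> in the generating function depends on \<open>x\<close>, and
  its coefficients are polynomials in \<open>x\<close>. This makes
  \<open>poly_antiperiodic_eq_0\<close> applicable.\<close>

lemma euler_poly_is_poly: "\<exists>p. \<forall>x. euler_poly m x = poly p x"
proof -
  define h where "h = inverse (fps_exp 1 + 1 :: real fps)"
  have eq: "2 * fps_exp x / (fps_exp 1 + 1) = fps_const 2 * (fps_exp x * h)" for x :: real
    unfolding h_def by (simp add: fps_divide_unit mult.assoc numeral_fps_const)
  then have "euler_poly m x = poly (\<Sum>i=0..m. monom (fact m * 2 * (fps_nth h (m - i) / fact i)) i) x" for x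
    unfolding euler_poly_def eq fps_mult_left_const_nth
    unfolding fps_mult_nth poly_sum poly_monom sum_distrib_left
    by (intro sum.cong) simp_all
  then show ?thesis by blast
qed

lemma euler_poly_shift: "euler_poly m (x + 1) + euler_poly m x = 2 * x ^ m"
proof -
  define A where "A x = Abs_fps (\<lambda>m. euler_poly m x / fact m)" for x
  have A: "A x * (fps_exp 1 + 1) = 2 * fps_exp x" for x
    unfolding A_def by (rule euler_poly_fps)
  have "(A (x + 1) + A x) * (fps_exp 1 + 1) = 2 * fps_exp x * (fps_exp 1 + 1)"
    by (simp only: distrib_right[of "A (x + 1)" "A x"] A) (simp add: fps_exp_add_mult algebra_simps)
  moreover have "fps_nth (fps_exp 1 + 1 :: real fps) 0 \<noteq> 0" by simp
  then have "(fps_exp 1 + 1 :: real fps) \<noteq> 0" by fastforce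
  ultimately have "A (x + 1) + A x = 2 * fps_exp x" by simp
  then have "fps_nth (A (x + 1) + A x) m = fps_nth (2 * fps_exp x) m" by simp
  then show ?thesis
    by (simp add: A_def numeral_fps_const field_simps)
qed

text \<open>The difference of the two sides is antiperiodic, by \<open>euler_poly_shift\<close> at
  \<open>-y\<close> and at \<open>y\<close>.\<close>

lemma euler_poly_reflect: "euler_poly m (1 - x) = (-1) ^ m * euler_poly m x"
proof -
  obtain p where p: "\<And>x. euler_poly m x = poly p x"
    using euler_poly_is_poly by blast
  define q where "q = pcompose p [:1, -1:] - smult ((-1) ^ m) p"
  have q: "poly q y = euler_poly m (1 - y) - (-1) ^ m * euler_poly m y" for y
    by (simp add: q_def poly_pcompose p)
  have "q = 0"
  proof (rule poly_antiperiodic_eq_0)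
    fix y
    have "poly q (y + 1) + poly q y = (euler_poly m (- y + 1) + euler_poly m (- y)) -
        (-1) ^ m * (euler_poly m (y + 1) + euler_poly m y)"
      unfolding q by (simp add: algebra_simps)
    also have "\<dots> = 0"
      unfolding euler_poly_shift by (subst power_minus) simp
    finally show "poly q (y + 1) = - poly q y" by simp
  qed
  with q[of x] show ?thesis by simp
qed

section \<open>First kind, even index\<close>

lemma cauchy1_even:
  assumes "n \<ge> 1"
  shows "cauchy1 (2 * n) x = real n * (\<Sum>m=1..n. central_factorial n m / real m *
    ((x + real n - 1) ^ (2 * m) - bernoulli (2 * m)))"
proof -
  obtain F :: "real poly" where F: "pderiv F = (\<Prod>i<2 * n. [:- real i, 1:])"
    using poly_antideriv_exists by blast
  have F': "poly (pderiv F) s = (\<Prod>i<2 * n. s - real i)" for s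
    by (simp add: F poly_prod)
  define G where "G = pcompose F [:real n, -1:]"
  define R where "R = (\<Sum>m=1..n. monom (real n * central_factorial n m / real m) (2 * m))"
  define D where "D = G - pcompose G [:1, 1:]"
  have D: "poly D z = poly F (real n - z) - poly F (real n - 1 - z)" for z
    by (simp add: D_def G_def poly_pcompose algebra_simps)
  have D': "poly (pderiv D) z = poly (pderiv F) (real n - 1 - z) - poly (pderiv F) (real n - z)" for z
    by (simp add: D_def G_def pderiv_pcompose pderiv_diff pderiv_pCons poly_pcompose algebra_simps)
  \<comment> \<open>The factor \<open>z\<close> is what \<open>prod_centered\<close> requires; it
    cancels afterwards.\<close>
  have "[:0, 1:] * pderiv D = [:0, 1:] * pderiv R"
  proof (rule poly_eq_poly_eq_iff[THEN iffD1], rule ext)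
    fix z
    \<comment> \<open>The \<open>2n-1\<close> factors common to both products; the remaining factors
      \<open>-z-n\<close> and \<open>n-z\<close> differ by \<open>-2n\<close>.\<close>
    define a where "a = (\<Prod>i<2 * (n - 1) + 1. real (n - 1) - z - real i)"
    have n: "2 * n = Suc (2 * (n - 1) + 1)" using assms by simp
    have "(\<Prod>i<2 * n. real n - z - real i) = (real n - z) * a"
      unfolding n a_def by (subst prod.lessThan_Suc_shift) (use assms in \<open>simp add: of_nat_diff algebra_simps\<close>)
    moreover have "(\<Prod>i<2 * n. real n - 1 - z - real i) = a * (- z - real n)"
      unfolding n a_def by (subst prod.lessThan_Suc) (use assms in \<open>simp add: of_nat_diff algebra_simps\<close>)
    ultimately have "z * poly (pderiv D) z = - 2 * real n * (z * a)"
      unfolding D' F' by (simp only:) (simp add: algebra_simps)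
    also have "z * a = - (\<Prod>j<n. z ^ 2 - real j ^ 2)"
      unfolding a_def prod_centered using assms by simp
    also have "- 2 * real n * \<dots> = 2 * real n * (\<Sum>m=1..n. central_factorial n m * z ^ (2 * m))"
      by (simp add: central_factorial_expansion[OF assms])
    also have "\<dots> = z * poly (pderiv R) z"
      unfolding R_def pderiv_sum poly_sum sum_distrib_left
    proof (intro sum.cong refl)
      fix m assume "m \<in> {1..n}"
      then have "z ^ (2 * m) = z * z ^ (2 * m - 1)" by (simp flip: power_Suc)
      with \<open>m \<in> {1..n}\<close> show "2 * real n * (central_factorial n m * z ^ (2 * m)) =
          z * poly (pderiv (monom (real n * central_factorial n m / real m) (2 * m))) z"
        by (simp add: pderiv_monom poly_monom)
    qed
    finally show "poly ([:0, 1:] * pderiv D) z = poly ([:0, 1:] * pderiv R) z" by simp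
  qed
  then have "pderiv (D - R) = 0" by (simp add: pderiv_diff)
  then have "degree (D - R) = 0" by (simp add: pderiv_eq_0_iff)
  then obtain C where "D - R = [:C:]" by (rule degree_eq_zeroE)
  \<comment> \<open>The constant is written as a monomial so that the functional sends it to
    \<open>C * bernoulli 0\<close>.\<close>
  then have DR: "D = R + monom C 0" by (simp add: algebra_simps monom_0)
  have "poly (pderiv F) (real n) = 0"
    unfolding F' using assms by (auto intro!: prod_zero bexI[of _ n])
  then have "coeff G 1 = 0"
    using coeff_pderiv[of G 0]
    by (simp add: G_def pderiv_pcompose pderiv_pCons poly_pcompose flip: poly_0_coeff_0)
  moreover have "bernoulli_functional (- 1 * D) = - bernoulli_functional D"
    using bernoulli_functional_smult[of "-1" D] by simp
  ultimately have "bernoulli_functional D = 0"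
    using bernoulli_functional_shift[of G] by (simp add: D_def)
  moreover have "bernoulli 0 = 1"
    using bernoulli_recurrence[of 1] by simp
  ultimately have "C = - (\<Sum>m=1..n. real n * central_factorial n m / real m * bernoulli (2 * m))"
    unfolding DR R_def
    by (simp add: bernoulli_functional_add bernoulli_functional_sum bernoulli_functional_monom)
  moreover have "cauchy1 (2 * n) x = poly D (x + real n - 1)"
    by (simp add: cauchy1_conv_antideriv[OF F'] D)
  ultimately show ?thesis
    by (simp add: DR R_def poly_sum poly_monom sum_distrib_left sum_subtractf right_diff_distrib mult.assoc)
qed

section \<open>First kind, odd index\<close>

lemma cauchy1_odd:
  assumes "n \<ge> 1"
  shows "cauchy1 (2 * n + 1) x = - real (2 * n + 1) *
    (\<Sum>m=1..n. central_factorial n m / real (2 * m + 1) * euler_poly (2 * m + 1) (x + real n))"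
proof -
  obtain F :: "real poly" where F: "pderiv F = (\<Prod>i<2 * n + 1. [:- real i, 1:])"
    using poly_antideriv_exists by blast
  have F': "poly (pderiv F) s = (\<Prod>i<2 * n + 1. s - real i)" for s
    unfolding F poly_prod by simp
  define S where "S z = (\<Sum>m=1..n. central_factorial n m / real (2 * m + 1) * z ^ (2 * m + 1))" for z
  define T where "T z = (\<Sum>m=1..n. central_factorial n m / real (2 * m + 1) * euler_poly (2 * m + 1) z)" for z
  note dpoly = poly_DERIV[THEN DERIV_chain2]
  \<comment> \<open>With \<open>x = z - n\<close>, the sum of the values at \<open>x\<close> and
    \<open>x + 1\<close> telescopes to this difference of two values of \<open>F\<close>.\<close>
  have deriv: "((\<lambda>z. poly F (real n + 1 - z) - poly F (real n - 1 - z) + 2 * real (2 * n + 1) * S z)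
      has_real_derivative 0) (at z)" for z
  proof -
    \<comment> \<open>Again the common factors. The remaining quadratics satisfy
      \<open>(z+n)(z+n+1) - (n+1-z)(n-z) = 2(2n+1)z\<close>.\<close>
    define a where "a = (\<Prod>i<2 * (n - 1) + 1. real (n - 1) - z - real i)"
    have n: "2 * n + 1 = Suc (Suc (2 * (n - 1) + 1))" using assms by simp
    have "(\<Prod>i<2 * n + 1. real n + 1 - z - real i) = (real n + 1 - z) * ((real n - z) * a)"
      unfolding n a_def
      by (subst prod.lessThan_Suc_shift, subst prod.lessThan_Suc_shift)
        (use assms in \<open>simp add: of_nat_diff algebra_simps\<close>)
    moreover have "(\<Prod>i<2 * n + 1. real n - 1 - z - real i) = a * (- z - real n) * (- z - real n - 1)"
      unfolding n a_def
      by (subst prod.lessThan_Suc, subst prod.lessThan_Suc)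
        (use assms in \<open>simp add: of_nat_diff algebra_simps\<close>)
    ultimately have "poly (pderiv F) (real n - 1 - z) - poly (pderiv F) (real n + 1 - z) =
        2 * real (2 * n + 1) * (z * a)"
      unfolding F' by (simp only:) (simp add: algebra_simps)
    also have "z * a = - (\<Prod>j<n. z ^ 2 - real j ^ 2)"
      unfolding a_def prod_centered using assms by simp
    also have "\<dots> = - (\<Sum>m=1..n. central_factorial n m * z ^ (2 * m))"
      by (simp add: central_factorial_expansion[OF assms])
    finally have eq: "poly (pderiv F) (real n - 1 - z) - poly (pderiv F) (real n + 1 - z) +
        2 * real (2 * n + 1) * (\<Sum>m=1..n. central_factorial n m * z ^ (2 * m)) = 0" by simp
    have "(S has_real_derivative (\<Sum>m=1..n. central_factorial n m * z ^ (2 * m))) (at z)"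
      unfolding S_def
    proof (rule DERIV_sum)
      fix m
      show "((\<lambda>z. central_factorial n m / real (2 * m + 1) * z ^ (2 * m + 1))
          has_real_derivative central_factorial n m * z ^ (2 * m)) (at z)"
        using DERIV_cmult[OF DERIV_pow[of "2 * m + 1" z UNIV], of "central_factorial n m / real (2 * m + 1)"]
        by (simp del: of_nat_Suc)
    qed
    then show ?thesis
      \<comment> \<open>Replaces the derivative 0 by the expression that the differentiation rules
        produce.\<close>
      unfolding eq[symmetric]
      by (auto intro!: derivative_eq_intros dpoly)
  qed
  \<comment> \<open>Since \<open>F'\<close> is odd about \<open>n\<close>, \<open>F\<close> is even
    about \<open>n\<close>; the case \<open>w = 1\<close> fixes the constant of integration in
    \<open>shift\<close>.\<close>
  have "((\<lambda>w. poly F (real n + w) - poly F (real n - w)) has_real_derivative 0) (at w)" for w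
    using prod_centered_odd[of n w] by (auto intro!: derivative_eq_intros dpoly simp: F')
  then have "poly F (real n + 1) - poly F (real n - 1) = poly F (real n + 0) - poly F (real n - 0)"
    using DERIV_isconst_all[of "\<lambda>w. poly F (real n + w) - poly F (real n - w)"] by blast
  then have F1: "poly F (real n + 1) = poly F (real n - 1)" by simp
  have shift: "poly F (real n + 1 - z) - poly F (real n - 1 - z) = - 2 * real (2 * n + 1) * S z" for z
  proof -
    have "poly F (real n + 1 - z) - poly F (real n - 1 - z) + 2 * real (2 * n + 1) * S z =
        poly F (real n + 1 - 0) - poly F (real n - 1 - 0) + 2 * real (2 * n + 1) * S 0"
      using DERIV_isconst_all[of "\<lambda>z. poly F (real n + 1 - z) - poly F (real n - 1 - z) + 2 * real (2 * n + 1) * S z"]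
        deriv by blast
    also have "\<dots> = 0" by (simp add: F1 S_def)
    finally show ?thesis by linarith
  qed
  obtain e where e: "\<And>m z. euler_poly m z = poly (e m) z"
    using euler_poly_is_poly by metis
  \<comment> \<open>The left side of the claim minus its right side at
    \<open>x = z - n\<close>.\<close>
  define p where "p = pcompose F [:real n + 1, -1:] - pcompose F [:real n, -1:] +
    smult (real (2 * n + 1)) (\<Sum>m=1..n. smult (central_factorial n m / real (2 * m + 1)) (e (2 * m + 1)))"
  have p: "poly p z = poly F (real n + 1 - z) - poly F (real n - z) + real (2 * n + 1) * T z" for z
    by (simp add: p_def T_def poly_pcompose poly_sum e)
  have "p = 0"
  proof (rule poly_antiperiodic_eq_0)
    fix z
    have "T (z + 1) + T z = 2 * S z"
      unfolding T_def S_def sum_distrib_left sum.distrib[symmetric]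
      by (intro sum.cong refl) (simp only: distrib_left[symmetric] euler_poly_shift, simp)
    then have "real (2 * n + 1) * T (z + 1) + real (2 * n + 1) * T z = 2 * real (2 * n + 1) * S z"
      by (metis distrib_left mult.left_commute mult.assoc)
    moreover have "real n + 1 - (z + 1) = real n - z" "real n - (z + 1) = real n - 1 - z" by simp_all
    then have "poly p (z + 1) = poly F (real n - z) - poly F (real n - 1 - z) + real (2 * n + 1) * T (z + 1)"
      using p[of "z + 1"] by (simp only:)
    ultimately show "poly p (z + 1) = - poly p z"
      using p[of z] shift[of z] by linarith
  qed
  then have "poly F (1 - x) - poly F (- x) = - (real (2 * n + 1) * T (x + real n))"
    using p[of "x + real n"] by simp
  then show ?thesis
    unfolding cauchy1_conv_antideriv[OF F'] T_def by (simp only: mult_minus_left)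
qed

section \<open>Both kinds together\<close>

theorem theorem4:
  fixes n :: nat and x :: real
  assumes "n \<ge> 1"
  shows "cauchy1 (2 * n) x =
      real n * (\<Sum>m=1..n. central_factorial n m / real m *
        ((x + real n - 1) ^ (2 * m) - bernoulli (2 * m))) \<and>
    cauchy2 (2 * n) x =
      real n * (\<Sum>m=1..n. central_factorial n m / real m *
        ((x - real n) ^ (2 * m) - bernoulli (2 * m))) \<and>
    cauchy1 (2 * n + 1) x =
      - real (2 * n + 1) * (\<Sum>m=1..n. central_factorial n m / real (2 * m + 1) *
        euler_poly (2 * m + 1) (x + real n)) \<and>
    cauchy2 (2 * n + 1) x =
      real (2 * n + 1) * (\<Sum>m=1..n. central_factorial n m / real (2 * m + 1) *
        euler_poly (2 * m + 1) (x - real n))"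
proof (intro conjI)
  \<comment> \<open>Replacing \<open>x\<close> by \<open>1 - x\<close> turns the base into
    \<open>n - x\<close>, whose sign the even power absorbs.\<close>
  have "(1 - x + real n - 1) ^ (2 * m) = (x - real n) ^ (2 * m)" for m
    by (simp add: power_mult power2_commute)
  then show "cauchy2 (2 * n) x = real n * (\<Sum>m=1..n. central_factorial n m / real m *
      ((x - real n) ^ (2 * m) - bernoulli (2 * m)))"
    using cauchy1_even[OF assms, of "1 - x"] by (simp only: cauchy2_conv_cauchy1)
  \<comment> \<open>Here the argument is \<open>1 - (x - n)\<close>; the sign from reflection at odd
    index cancels the leading minus.\<close>
  have "euler_poly (2 * m + 1) (1 - x + real n) = - euler_poly (2 * m + 1) (x - real n)" for m
    using euler_poly_reflect[of "2 * m + 1" "x - real n"] by (simp add: algebra_simps)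
  then show "cauchy2 (2 * n + 1) x = real (2 * n + 1) *
      (\<Sum>m=1..n. central_factorial n m / real (2 * m + 1) * euler_poly (2 * m + 1) (x - real n))"
    using cauchy1_odd[OF assms, of "1 - x"]
    by (simp only: cauchy2_conv_cauchy1 mult_minus_right sum_negf minus_mult_minus)
qed (fact cauchy1_even[OF assms] cauchy1_odd[OF assms])+

end
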